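(* Let $(X,d)$ be a compact metric space and let $\mathcal K(X)$ be the set of all non-empty compact subsets of $X$, equipped with the Hausdorff metric. The function $\Delta_{\mathrm A}:\mathcal K(X)\to\mathbb R$ defined by \[ \Delta_{\mathrm A}(F)=\dim_{\mathrm A}F \] is of Baire class 2 and, in particular, Borel measurable.
   Context: The Hausdorff metric is $d_{\mathcal H}(E,F)=\inf\{\varepsilon>0: E\subseteq F_\varepsilon\text{ and }F\subseteq E_\varepsilon\}$ for $E,F\in\mathcal K(X)$, where $E_\varepsilon$ denotes the $\varepsilon$-neighbourhood of $E$. A function $f:A\to B$ between metric spaces is of Baire class 0 if it is continuous; inductively, it is of Baire class $n+1$ if it is in the pointwise closure of the Baire class $n$ functions. For $r>0$ and a non-empty set $F\subseteq X$, $N_r(F)$ denotes the smallest number of open sets with diameter less than or equal to $r$ required to cover $F$, and $B(x,R)$ is the (closed) ball of centre $x$ and radius $R$. The Assouad dimension of $F$ is \[ \dim_{\mathrm A}F=\inf\Big\{\alpha:\ \text{there exist } C,\rho>0 \text{ such that, for all } 0<r<R\leq\rho,\ \sup_{x\in F}N_r\big(B(x,R)\cap F\big)\leq C \Big(\frac{R}{r}\Big)^{\alpha}\Big\}. \]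
   Formalization: The Assouad dimension of a compact set can be infinite, so the function is taken with values in the extended reals (infimum of the empty set is ∞); the claim for a function into the reals is proved as well whenever the dimension of every non-empty compact subset is finite. *)

theory Defs
  imports "HOL-Analysis.Analysis"
begin

definition nbhd :: "real \<Rightarrow> 'a::metric_space set \<Rightarrow> 'a set" where
  "nbhd \<epsilon> E = (\<Union>x\<in>E. ball x \<epsilon>)"

definition hausdorff_dist :: "'a::metric_space set \<Rightarrow> 'a set \<Rightarrow> real" where
  "hausdorff_dist E F = Inf {\<epsilon>. \<epsilon> > 0 \<and> E \<subseteq> nbhd \<epsilon> F \<and> F \<subseteq> nbhd \<epsilon> E}"

lemma hausdorff_dist_le:
  assumes "\<epsilon> > 0" "E \<subseteq> nbhd \<epsilon> F" "F \<subseteq> nbhd \<epsilon> E"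
  shows "hausdorff_dist E F \<le> \<epsilon>"
  unfolding hausdorff_dist_def
  by (rule cInf_lower) (use assms in \<open>auto intro!: bdd_belowI[of _ 0]\<close>)

lemma nbhd_mono: "\<epsilon> \<le> \<delta> \<Longrightarrow> nbhd \<epsilon> E \<subseteq> nbhd \<delta> E"
  unfolding nbhd_def by (intro UN_mono subset_ball) auto

lemma nbhd_nbhd: "nbhd \<epsilon> (nbhd \<delta> E) \<subseteq> nbhd (\<delta> + \<epsilon>) E"
proof
  fix z assume "z \<in> nbhd \<epsilon> (nbhd \<delta> E)"
  then obtain x y where "x \<in> E" "dist x y < \<delta>" "dist y z < \<epsilon>"
    by (auto simp: nbhd_def)
  then have "dist x z < \<delta> + \<epsilon>"
    using dist_triangle[of x z y] by linarith
  with \<open>x \<in> E\<close> show "z \<in> nbhd (\<delta> + \<epsilon>) E" by (auto simp: nbhd_def)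
qed

lemma nbhd_subset_mono: "E \<subseteq> F \<Longrightarrow> nbhd \<epsilon> E \<subseteq> nbhd \<epsilon> F"
  by (auto simp: nbhd_def)

lemma hausdorff_dist_witness:
  fixes E F :: "'a::metric_space set"
  assumes E: "compact E" "E \<noteq> {}" and F: "compact F" "F \<noteq> {}"
    and less: "hausdorff_dist E F < \<epsilon>"
  shows "\<epsilon> > 0" "E \<subseteq> nbhd \<epsilon> F" "F \<subseteq> nbhd \<epsilon> E"
proof -
  let ?S = "{\<epsilon>. \<epsilon> > 0 \<and> E \<subseteq> nbhd \<epsilon> F \<and> F \<subseteq> nbhd \<epsilon> E}"
  have "bounded (E \<union> F)" using E F compact_imp_bounded by auto
  then obtain m where m: "\<And>x y. x \<in> E \<union> F \<Longrightarrow> y \<in> E \<union> F \<Longrightarrow> dist x y \<le> m"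
    unfolding bounded_two_points by blast
  define M where "M = max m 0 + 1"
  have M: "M > 0" "\<And>x y. x \<in> E \<union> F \<Longrightarrow> y \<in> E \<union> F \<Longrightarrow> dist x y < M"
    using m by (fastforce simp: M_def)+
  obtain e f where "e \<in> E" "f \<in> F" using E F by auto
  then have "M \<in> ?S" using M by (fastforce simp: nbhd_def)
  then have ne: "?S \<noteq> {}" by blast
  have "Inf ?S < \<epsilon>" using less by (simp add: hausdorff_dist_def)
  then obtain \<delta> where \<delta>: "\<delta> \<in> ?S" "\<delta> < \<epsilon>" using cInf_lessD[OF ne] by blast
  then show "\<epsilon> > 0" by auto
  show "E \<subseteq> nbhd \<epsilon> F" "F \<subseteq> nbhd \<epsilon> E"
    using \<delta> nbhd_mono[of \<delta> \<epsilon> E] nbhd_mono[of \<delta> \<epsilon> F] by auto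
qed

lemma hausdorff_dist_nonneg:
  fixes E F :: "'a::metric_space set"
  assumes "compact E" "E \<noteq> {}" "compact F" "F \<noteq> {}"
  shows "0 \<le> hausdorff_dist E F"
  using hausdorff_dist_witness(1)[OF assms] by (meson linorder_not_less order_less_irrefl)

lemma hausdorff_dist_commute: "hausdorff_dist E F = hausdorff_dist F E"
  unfolding hausdorff_dist_def by (rule arg_cong[where f = Inf]) auto

lemma hausdorff_dist_triangle:
  fixes E F G :: "'a::metric_space set"
  assumes E: "compact E" "E \<noteq> {}" and F: "compact F" "F \<noteq> {}" and G: "compact G" "G \<noteq> {}"
  shows "hausdorff_dist E G \<le> hausdorff_dist E F + hausdorff_dist F G"
proof (rule field_le_epsilon)
  fix e :: real assume "e > 0"
  define a where "a = hausdorff_dist E F + e / 2"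
  define b where "b = hausdorff_dist F G + e / 2"
  have "hausdorff_dist E F < a" "hausdorff_dist F G < b"
    using \<open>e > 0\<close> by (auto simp: a_def b_def)
  note A = hausdorff_dist_witness[OF E F this(1)] and B = hausdorff_dist_witness[OF F G this(2)]
  have "E \<subseteq> nbhd (b + a) G"
    using A(2) B(2) nbhd_subset_mono[of F "nbhd b G" a] nbhd_nbhd[of a b G] by blast
  moreover have "G \<subseteq> nbhd (a + b) E"
    using A(3) B(3) nbhd_subset_mono[of F "nbhd a E" b] nbhd_nbhd[of b a E] by blast
  ultimately have "hausdorff_dist E G \<le> a + b"
    using A(1) B(1) by (intro hausdorff_dist_le) (auto simp: add.commute)
  then show "hausdorff_dist E G \<le> hausdorff_dist E F + hausdorff_dist F G + e"
    by (simp add: a_def b_def)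
qed

lemma hausdorff_dist_zero_subset:
  fixes E F :: "'a::metric_space set"
  assumes E: "compact E" "E \<noteq> {}" and F: "compact F" "F \<noteq> {}" and z: "hausdorff_dist E F = 0"
  shows "E \<subseteq> F"
proof
  fix x assume "x \<in> E"
  have "\<exists>y\<in>F. dist y x < e" if "e > 0" for e
    using hausdorff_dist_witness(2)[OF E F, of e] that z \<open>x \<in> E\<close>
    by (fastforce simp: nbhd_def)
  then have "x \<in> closure F" by (simp add: closure_approachable)
  then show "x \<in> F" using F(1) compact_imp_closed by (metis closure_closed)
qed

lemma hausdorff_dist_self: "hausdorff_dist E E = 0" if "compact E" "E \<noteq> {}" for E :: "'a::metric_space set"
proof (rule antisym)
  show "hausdorff_dist E E \<le> 0"
  proof (rule field_le_epsilon)
    fix e :: real assume "e > 0"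
    then have "hausdorff_dist E E \<le> e" by (intro hausdorff_dist_le) (force simp: nbhd_def)+
    then show "hausdorff_dist E E \<le> 0 + e" by simp
  qed
qed (use hausdorff_dist_nonneg that in auto)

typedef (overloaded) ('a::topological_space) compacts = "{K :: 'a set. compact K \<and> K \<noteq> {}}"
  morphisms set_of_compacts Abs_compacts
  by (rule exI[of _ "{undefined}"]) simp

lemma set_of_compacts: "compact (set_of_compacts K)" "set_of_compacts K \<noteq> {}"
  using set_of_compacts[of K] by auto

instantiation compacts :: (metric_space) metric_space
begin

definition dist_compacts :: "'a compacts \<Rightarrow> 'a compacts \<Rightarrow> real" where
  "dist_compacts K L = hausdorff_dist (set_of_compacts K) (set_of_compacts L)"

definition uniformity_compacts :: "('a compacts \<times> 'a compacts) filter" where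
  "uniformity_compacts = (INF e\<in>{0<..}. principal {(K, L). dist K L < e})"

definition open_compacts :: "'a compacts set \<Rightarrow> bool" where
  "open_compacts U \<longleftrightarrow> (\<forall>K\<in>U. \<forall>\<^sub>F (K', L) in uniformity. K' = K \<longrightarrow> L \<in> U)"

instance
proof
  fix K L M :: "'a compacts"
  note [simp] = set_of_compacts
  show "(dist K L = 0) = (K = L)"
  proof
    assume "dist K L = 0"
    then have "hausdorff_dist (set_of_compacts K) (set_of_compacts L) = 0"
      "hausdorff_dist (set_of_compacts L) (set_of_compacts K) = 0"
      by (simp_all add: dist_compacts_def hausdorff_dist_commute)
    then have "set_of_compacts K = set_of_compacts L"
      by (intro equalityI hausdorff_dist_zero_subset) simp_all
    then show "K = L" by (simp add: set_of_compacts_inject)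
  qed (simp add: dist_compacts_def hausdorff_dist_self)
  have "dist K L \<le> dist K M + dist M L"
    unfolding dist_compacts_def by (rule hausdorff_dist_triangle) simp_all
  then show "dist K L \<le> dist K M + dist L M"
    by (simp add: dist_compacts_def hausdorff_dist_commute)
qed (simp_all add: uniformity_compacts_def open_compacts_def)

end

text \<open>The sorts are topological, not metric, because \<^typ>\<open>ereal\<close>, although metrizable, is no
  instance of \<^class>\<open>metric_space\<close>. Pointwise closure means limits of sequences.\<close>
primrec baire_class :: "nat \<Rightarrow> ('a::topological_space \<Rightarrow> 'b::topological_space) \<Rightarrow> bool" where
  "baire_class 0 f \<longleftrightarrow> continuous_on UNIV f"
| "baire_class (Suc n) f \<longleftrightarrow>
     (\<exists>g. (\<forall>k. baire_class n (g k)) \<and> (\<forall>x. (\<lambda>k. g k x) \<longlonglongrightarrow> f x))"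

text \<open>Boundedness is required because \<^const>\<open>diameter\<close> is a real number, without meaning on
  unbounded sets. The value is \<open>\<infinity>\<close> if there is no finite cover.\<close>
definition covering_number :: "real \<Rightarrow> 'a::metric_space set \<Rightarrow> enat" where
  "covering_number r F =
     (INF \<U>\<in>{\<U>. finite \<U> \<and> (\<forall>U\<in>\<U>. open U \<and> bounded U \<and> diameter U \<le> r) \<and> F \<subseteq> \<Union>\<U>}.
        enat (card \<U>))"

text \<open>The infimum is taken in the extended reals, so the dimension is \<open>\<infinity>\<close> if no exponent is
  admissible. This does happen for compact sets.\<close>
definition assouad_dim :: "'a::metric_space set \<Rightarrow> ereal" where
  "assouad_dim F = Inf (ereal ` {\<alpha>. \<exists>C>0. \<exists>\<rho>>0. \<forall>r R. 0 < r \<and> r < R \<and> R \<le> \<rho> \<longrightarrow>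
     (SUP x\<in>F. ereal_of_enat (covering_number r (cball x R \<inter> F))) \<le> ereal (C * (R / r) powr \<alpha>)})"

definition Delta_A :: "'a::metric_space compacts \<Rightarrow> ereal" where
  "Delta_A F = assouad_dim (set_of_compacts F)"

end

theory Submission
  imports Defs
begin

text \<open>
  The idea is to write the Assouad dimension as a decreasing limit of lower semicontinuous
  functions; lower semicontinuous functions are limits of continuous ones, so two limits suffice.

  The covering numbers \<open>N\<^sub>r(B(x,R) \<inter> F)\<close> themselves are upper semicontinuous in \<open>F\<close>, which is the
  wrong direction. They are therefore replaced by packing numbers: a finite set \<open>S \<subseteq> F\<close> inside
  an \<^emph>\<open>open\<close> ball of radius \<open>R\<close> whose points have mutual distances \<^emph>\<open>strictly\<close> above \<open>r\<close> survives
  small perturbations of \<open>F\<close> in the Hausdorff metric, because all the inequalities are strict.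
  The change is harmless for the dimension: an open set of diameter at most \<open>r\<close> contains
  at most one point of such an \<open>S\<close>, and a largest \<open>r/4\<close>-separated set gives a cover by balls of
  radius \<open>r/2\<close>, so the two kinds of numbers agree up to constant factors in \<open>r\<close> and \<open>R\<close>, which are
  absorbed by the constants in the definition of the dimension.

  Coupling the two constants as \<open>C = n + 1\<close> and \<open>\<rho> = 1 / (n + 1)\<close> and solving the inequality
  \<open>card S \<le> C (R/r)\<^sup>\<alpha>\<close> for \<open>\<alpha>\<close> turns the best exponent for given \<open>n\<close> into a supremum of logarithms,
  \<open>packing_exponent n F\<close>. A condition satisfied by one packing is open in \<open>F\<close>, so this supremum is
  lower semicontinuous (\<open>open_packing_exponent_greater\<close>), and it decreases to \<open>dim\<^sub>A F\<close>
  (\<open>assouad_dim_eq_INF_packing_exponent\<close>). Clipping the \<open>n\<close>th function to \<open>[-n, n]\<close> keeps the limit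
  and lower semicontinuity and makes all approximants real-valued, so that one
  double sequence serves both the extended-real and the real version of the theorem.
\<close>

section \<open>Baire classes, semicontinuity and measurability\<close>

text \<open>The approximants are the inf-convolutions \<open>x \<mapsto> inf\<^sub>y (f y + k d(x,y))\<close>, which are
  \<open>k\<close>-Lipschitz. If \<open>f > t\<close> on the ball of radius \<open>\<delta>\<close> about \<open>x\<close>, then points \<open>y\<close> in the
  ball contribute more than \<open>t\<close>, and the others at least \<open>c + k\<delta>\<close>, which exceeds \<open>t\<close> for large \<open>k\<close>.\<close>

lemma lower_semicontinuous_imp_baire_class_1:
  fixes f :: "'a::metric_space \<Rightarrow> real"
  assumes lower: "\<And>x. c \<le> f x" and lsc: "\<And>t. open {x. t < f x}"
  shows "baire_class 1 f"
proof -
  define g where "g k x = (INF y. f y + real k * dist x y)" for k x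
  have bdd: "bdd_below (range (\<lambda>y. f y + real k * dist x y))" for k x
    by (rule bdd_belowI[of _ c]) (auto intro!: add_increasing2 lower)
  have g_le: "g k x \<le> f y + real k * dist x y" for k x y
    unfolding g_def by (rule cINF_lower[OF bdd]) simp
  have Lipschitz: "g k x \<le> g k z + real k * dist x z" for k x z
  proof -
    have "g k x - real k * dist x z \<le> g k z"
      unfolding g_def[of k z]
    proof (rule cINF_greatest)
      fix y
      have "real k * dist x y \<le> real k * dist x z + real k * dist z y"
        using mult_left_mono[OF dist_triangle[of x y z], of "real k"] by (simp add: algebra_simps)
      then show "g k x - real k * dist x z \<le> f y + real k * dist z y"
        using g_le[of k x y] by linarith
    qed simp
    then show ?thesis by linarith
  qed
  have "continuous_on UNIV (g k)" for k
  proof (rule continuous_onI)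
    fix x :: 'a and e :: real
    assume "e > 0"
    have "dist (g k z) (g k x) \<le> e" if "dist z x < e / (real k + 1)" for z
    proof -
      have "real k * dist z x \<le> (real k + 1) * dist z x" by (simp add: mult_right_mono)
      also have "\<dots> \<le> e" using that by (simp add: field_simps)
      finally show ?thesis
        using Lipschitz[of k z x] Lipschitz[of k x z]
        by (simp add: dist_real_def abs_le_iff dist_commute)
    qed
    then show "\<exists>d>0. \<forall>z\<in>UNIV. dist z x < d \<longrightarrow> dist (g k z) (g k x) \<le> e"
      using \<open>e > 0\<close> by (intro exI[of _ "e / (real k + 1)"]) auto
  qed
  moreover have "(\<lambda>k. g k x) \<longlonglongrightarrow> f x" for x
  proof (rule order_tendstoI)
    fix u assume "f x < u"
    then show "\<forall>\<^sub>F k in sequentially. g k x < u"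
      using g_le[of _ x x] by (auto intro!: always_eventually intro: order_le_less_trans)
  next
    fix s assume "s < f x"
    then obtain t where t: "s < t" "t < f x" using dense by blast
    then obtain \<delta> where \<delta>: "\<delta> > 0" "\<And>y. dist y x < \<delta> \<Longrightarrow> t < f y"
      using lsc[of t] unfolding open_dist by auto
    obtain k0 :: nat where k0: "(t - c) / \<delta> < real k0" using reals_Archimedean2 by blast
    have "s < g k x" if "k \<ge> k0" for k
    proof -
      have "(t - c) / \<delta> < real k" using k0 that by linarith
      then have far: "t - c \<le> real k * \<delta>" using \<delta>(1) by (simp add: field_simps)
      have "t \<le> g k x"
        unfolding g_def
      proof (rule cINF_greatest)
        fix y
        show "t \<le> f y + real k * dist x y"
        proof (cases "dist y x < \<delta>")
          case True
          then show ?thesis using \<delta>(2)[of y] by (smt (verit) mult_nonneg_nonneg of_nat_0_le_iff zero_le_dist)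
        next
          case False
          then have "real k * \<delta> \<le> real k * dist x y"
            by (intro mult_left_mono) (auto simp: dist_commute)
          then show ?thesis using far lower[of y] by linarith
        qed
      qed simp
      then show ?thesis using t by linarith
    qed
    then show "\<forall>\<^sub>F k in sequentially. s < g k x"
      unfolding eventually_sequentially by blast
  qed
  ultimately show ?thesis by auto
qed

lemma baire_class_ereal:
  assumes "baire_class n f"
  shows "baire_class n (\<lambda>x. ereal (f x))"
  using assms
proof (induction n arbitrary: f)
  case 0
  then show ?case by (auto intro: continuous_on_ereal)
next
  case (Suc n)
  then obtain g where "\<And>k. baire_class n (g k)" "\<And>x. (\<lambda>k. g k x) \<longlonglongrightarrow> f x" by auto
  then show ?case using Suc.IH by (auto intro!: exI[of _ "\<lambda>k x. ereal (g k x)"])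
qed

lemma baire_class_imp_borel_measurable:
  fixes f :: "'a::topological_space \<Rightarrow> ereal"
  assumes "baire_class n f"
  shows "f \<in> borel_measurable borel"
  using assms
proof (induction n arbitrary: f)
  case 0
  then show ?case by (simp add: borel_measurable_continuous_onI)
next
  case (Suc n)
  then obtain g where g: "\<And>k. baire_class n (g k)" "\<And>x. (\<lambda>k. g k x) \<longlonglongrightarrow> f x" by auto
  have "f = (\<lambda>x. limsup (\<lambda>k. g k x))"
    using lim_imp_Limsup[OF _ g(2)] by (intro ext) simp
  moreover have "(\<lambda>x. limsup (\<lambda>k. g k x)) \<in> borel_measurable borel"
    using Suc.IH[OF g(1)] by measurable
  ultimately show ?case by simp
qed

section \<open>Packings and covering numbers\<close>

definition packing :: "real \<Rightarrow> real \<Rightarrow> 'a::metric_space set \<Rightarrow> 'a \<Rightarrow> 'a set \<Rightarrow> bool" where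
  "packing r R F x S \<longleftrightarrow>
     x \<in> F \<and> finite S \<and> S \<noteq> {} \<and> S \<subseteq> F \<inter> ball x R \<and> pairwise (\<lambda>y z. r < dist y z) S"

text \<open>An open set of diameter at most \<open>r\<close> cannot contain two points of the packing.\<close>

lemma card_packing_le_covering_number:
  assumes "packing r R F x S"
  shows "enat (card S) \<le> covering_number r (cball x R \<inter> F)"
  unfolding covering_number_def
proof (rule INF_greatest)
  fix \<U> :: "'a set set"
  assume "\<U> \<in> {\<U>. finite \<U> \<and> (\<forall>U\<in>\<U>. open U \<and> bounded U \<and> diameter U \<le> r) \<and> cball x R \<inter> F \<subseteq> \<Union>\<U>}"
  then have fin: "finite \<U>" and small: "\<And>U. U \<in> \<U> \<Longrightarrow> bounded U \<and> diameter U \<le> r"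
    and cover: "cball x R \<inter> F \<subseteq> \<Union>\<U>" by auto
  have "S \<subseteq> cball x R \<inter> F" using assms by (auto simp: packing_def)
  then have "\<forall>y\<in>S. \<exists>U\<in>\<U>. y \<in> U" using cover by blast
  then obtain u where u: "\<And>y. y \<in> S \<Longrightarrow> u y \<in> \<U> \<and> y \<in> u y" by metis
  have "inj_on u S"
  proof (rule inj_onI, rule ccontr)
    fix y z assume yz: "y \<in> S" "z \<in> S" "u y = u z" "y \<noteq> z"
    have "dist y z \<le> diameter (u y)"
      using u[OF yz(1)] u[OF yz(2)] small yz(3) by (intro diameter_bounded_bound) auto
    then have "dist y z \<le> r" using small u[OF yz(1)] by force
    moreover have "r < dist y z" using assms yz by (auto simp: packing_def pairwise_def)
    ultimately show False by simp
  qed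
  then have "card S \<le> card \<U>" using u fin by (intro card_inj_on_le[of u]) auto
  then show "enat (card S) \<le> enat (card \<U>)" by simp
qed

text \<open>Among the packings inside \<open>cball x R\<close> take one of largest cardinality. No further point
  of \<open>F\<close> in that ball can be added to it, so each such point is within \<open>r/4\<close> of the packing, and the
  open balls of radius \<open>r/2\<close> about the packing form a cover. The radius \<open>2R\<close> leaves room for the
  closed ball inside the open ball that the definition of a packing demands.\<close>

lemma covering_number_le_packing_bound:
  assumes r: "0 < r" and R: "0 < R" and x: "x \<in> F"
    and bound: "\<And>S. packing (r / 4) (2 * R) F x S \<Longrightarrow> card S \<le> m"
  shows "covering_number r (cball x R \<inter> F) \<le> enat m"
proof -
  define P where "P S \<longleftrightarrow> packing (r / 4) (2 * R) F x S \<and> S \<subseteq> cball x R" for S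
  have "P {x}" using x R by (auto simp: P_def packing_def)
  moreover have "\<forall>S. P S \<longrightarrow> card S \<le> m" using bound by (auto simp: P_def)
  ultimately obtain S where S: "P S" and max: "\<And>T. P T \<Longrightarrow> card T \<le> card S"
    using ex_has_greatest_nat[of P "{x}" card "Suc m"] by (metis le_imp_less_Suc)
  have fin: "finite S" using S by (auto simp: P_def packing_def)
  have near: "\<exists>s\<in>S. dist s y \<le> r / 4" if y: "y \<in> cball x R \<inter> F" for y
  proof (rule ccontr)
    assume far: "\<not> (\<exists>s\<in>S. dist s y \<le> r / 4)"
    then have "y \<notin> S" using r by force
    have "P (insert y S)"
      using S y far R by (auto simp: P_def packing_def pairwise_insert dist_commute)
    then show False using max[of "insert y S"] \<open>y \<notin> S\<close> fin by auto
  qed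
  define \<U> where "\<U> = (\<lambda>s. ball s (r / 2)) ` S"
  have "cball x R \<inter> F \<subseteq> \<Union>\<U>"
  proof
    fix y assume "y \<in> cball x R \<inter> F"
    with near obtain s where "s \<in> S" "dist s y \<le> r / 4" by blast
    then show "y \<in> \<Union>\<U>" using r by (auto simp: \<U>_def intro!: bexI[of _ s])
  qed
  moreover have "diameter (ball s (r / 2)) \<le> r" for s :: 'a
  proof -
    have "dist y z \<le> r" if "y \<in> ball s (r / 2)" "z \<in> ball s (r / 2)" for y z
      using that dist_triangle3[of y z s] by auto
    then show ?thesis using r by (auto simp: diameter_def intro!: cSUP_least)
  qed
  ultimately have "covering_number r (cball x R \<inter> F) \<le> enat (card \<U>)"
    unfolding covering_number_def using fin by (intro INF_lower) (auto simp: \<U>_def)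
  also have "card \<U> \<le> card S" unfolding \<U>_def by (rule card_image_le[OF fin])
  also have "card S \<le> m" using S bound by (auto simp: P_def)
  finally show ?thesis by simp
qed

section \<open>The Assouad dimension as a limit of packing exponents\<close>

definition packing_exponent :: "nat \<Rightarrow> 'a::metric_space set \<Rightarrow> ereal" where
  "packing_exponent n F =
     Sup {ereal (log (R / r) (real (card S) / real (Suc n))) | r R x S.
       0 < r \<and> r < R \<and> R \<le> 1 / real (Suc n) \<and> packing r R F x S}"

lemma packing_exponent_le_iff:
  "packing_exponent n F \<le> ereal \<alpha> \<longleftrightarrow>
     (\<forall>r R x S. 0 < r \<and> r < R \<and> R \<le> 1 / real (Suc n) \<and> packing r R F x S \<longrightarrow>
        real (card S) \<le> real (Suc n) * (R / r) powr \<alpha>)"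
proof -
  have "log (R / r) (real (card S) / real (Suc n)) \<le> \<alpha>
      \<longleftrightarrow> real (card S) \<le> real (Suc n) * (R / r) powr \<alpha>"
    if "0 < r" "r < R" "packing r R F x S" for r R x S
  proof -
    have "card S > 0" using that(3) by (auto simp: packing_def card_gt_0_iff)
    then have "log (R / r) (real (card S) / real (Suc n)) \<le> \<alpha>
        \<longleftrightarrow> real (card S) / real (Suc n) \<le> (R / r) powr \<alpha>"
      using that by (intro log_le_iff) auto
    also have "\<dots> \<longleftrightarrow> real (card S) \<le> real (Suc n) * (R / r) powr \<alpha>"
      by (subst pos_divide_le_eq) (auto simp: mult.commute)
    finally show ?thesis .
  qed
  then show ?thesis
    unfolding packing_exponent_def Sup_le_iff by (smt (verit, best) ereal_less_eq(3) mem_Collect_eq)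
qed

lemma decseq_packing_exponent: "decseq (\<lambda>n. packing_exponent n F)"
proof (rule decseq_SucI, rule ereal_le_real)
  fix n \<alpha> assume "packing_exponent n F \<le> ereal \<alpha>"
  then have *: "\<And>r R x S. 0 < r \<Longrightarrow> r < R \<Longrightarrow> R \<le> 1 / real (Suc n) \<Longrightarrow> packing r R F x S \<Longrightarrow>
      real (card S) \<le> real (Suc n) * (R / r) powr \<alpha>"
    unfolding packing_exponent_le_iff by blast
  show "packing_exponent (Suc n) F \<le> ereal \<alpha>"
    unfolding packing_exponent_le_iff
  proof (intro allI impI, elim conjE)
    fix r R x S
    assume "0 < r" "r < R" "R \<le> 1 / real (Suc (Suc n))" "packing r R F x S"
    moreover have "1 / real (Suc (Suc n)) \<le> 1 / real (Suc n)" by (simp add: field_simps)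
    ultimately have "real (card S) \<le> real (Suc n) * (R / r) powr \<alpha>" by (intro *) auto
    also have "\<dots> \<le> real (Suc (Suc n)) * (R / r) powr \<alpha>" by (intro mult_right_mono) auto
    finally show "real (card S) \<le> real (Suc (Suc n)) * (R / r) powr \<alpha>" .
  qed
qed

text \<open>The factor \<open>8\<close> is the ratio of \<open>2R / (r/4)\<close> to \<open>R / r\<close>, the price of passing
  from covers to packings; it only changes the constant \<open>C\<close>.\<close>

lemma assouad_dim_le_packing_exponent: "assouad_dim F \<le> packing_exponent n F"
proof (rule ereal_le_real)
  fix \<alpha> assume "packing_exponent n F \<le> ereal \<alpha>"
  then have bound: "\<And>r R x S. 0 < r \<Longrightarrow> r < R \<Longrightarrow> R \<le> 1 / real (Suc n) \<Longrightarrow> packing r R F x S \<Longrightarrow>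
      real (card S) \<le> real (Suc n) * (R / r) powr \<alpha>"
    unfolding packing_exponent_le_iff by blast
  define C where "C = real (Suc n) * 8 powr \<alpha>"
  define \<rho> where "\<rho> = 1 / (2 * real (Suc n))"
  have "(SUP x\<in>F. ereal_of_enat (covering_number r (cball x R \<inter> F))) \<le> ereal (C * (R / r) powr \<alpha>)"
    if rR: "0 < r" "r < R" "R \<le> \<rho>" for r R
  proof (rule SUP_least)
    fix x assume x: "x \<in> F"
    have nonneg: "0 \<le> C * (R / r) powr \<alpha>" by (simp add: C_def)
    have "card S \<le> nat \<lfloor>C * (R / r) powr \<alpha>\<rfloor>" if "packing (r / 4) (2 * R) F x S" for S
    proof -
      have "real (card S) \<le> real (Suc n) * (2 * R / (r / 4)) powr \<alpha>"
        using rR that by (intro bound) (auto simp: \<rho>_def field_simps)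
      also have "2 * R / (r / 4) = 8 * (R / r)" by simp
      also have "(8 * (R / r)) powr \<alpha> = 8 powr \<alpha> * (R / r) powr \<alpha>"
        by (rule powr_mult)
      finally show ?thesis by (simp add: C_def le_nat_floor mult.assoc)
    qed
    then have "covering_number r (cball x R \<inter> F) \<le> enat (nat \<lfloor>C * (R / r) powr \<alpha>\<rfloor>)"
      using rR x by (intro covering_number_le_packing_bound) auto
    then have "ereal_of_enat (covering_number r (cball x R \<inter> F))
        \<le> ereal_of_enat (enat (nat \<lfloor>C * (R / r) powr \<alpha>\<rfloor>))"
      by (simp only: ereal_of_enat_le_iff)
    also have "\<dots> \<le> ereal (C * (R / r) powr \<alpha>)"
      using nonneg by simp
    finally show "ereal_of_enat (covering_number r (cball x R \<inter> F)) \<le> ereal (C * (R / r) powr \<alpha>)" .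
  qed
  moreover have "C > 0" "\<rho> > 0" by (simp_all add: C_def \<rho>_def)
  ultimately show "assouad_dim F \<le> ereal \<alpha>"
    unfolding assouad_dim_def by (intro Inf_lower imageI CollectI) blast
qed

text \<open>Conversely, an exponent admissible with constants \<open>C\<close> and \<open>\<rho>\<close> bounds
  \<open>packing_exponent n F\<close> as soon as \<open>n + 1\<close> exceeds both \<open>C\<close> and \<open>1 / \<rho>\<close>.\<close>

lemma assouad_dim_eq_INF_packing_exponent: "assouad_dim F = (INF n. packing_exponent n F)"
proof (rule antisym)
  show "assouad_dim F \<le> (INF n. packing_exponent n F)"
    by (intro INF_greatest assouad_dim_le_packing_exponent)
  show "(INF n. packing_exponent n F) \<le> assouad_dim F"
    unfolding assouad_dim_def
  proof (rule Inf_greatest, elim imageE CollectE exE conjE)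
    fix \<alpha> C \<rho> :: real and a
    assume a: "a = ereal \<alpha>" and C: "0 < C" and \<rho>: "0 < \<rho>"
      and adm: "\<forall>r R. 0 < r \<and> r < R \<and> R \<le> \<rho> \<longrightarrow>
        (SUP x\<in>F. ereal_of_enat (covering_number r (cball x R \<inter> F))) \<le> ereal (C * (R / r) powr \<alpha>)"
    obtain n :: nat where n: "max C (1 / \<rho>) < real n" using reals_Archimedean2 by blast
    have n_C: "C \<le> real (Suc n)" and n_\<rho>: "1 / real (Suc n) \<le> \<rho>"
      using n \<rho> by (auto simp: field_simps)
    have "packing_exponent n F \<le> ereal \<alpha>"
      unfolding packing_exponent_le_iff
    proof (intro allI impI, elim conjE)
      fix r R x S
      assume rR: "0 < r" "r < R" "R \<le> 1 / real (Suc n)" and S: "packing r R F x S"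
      have "ereal (real (card S)) = ereal_of_enat (enat (card S))" by simp
      also have "\<dots> \<le> ereal_of_enat (covering_number r (cball x R \<inter> F))"
        using card_packing_le_covering_number[OF S] by (simp only: ereal_of_enat_le_iff)
      also have "\<dots> \<le> (SUP x\<in>F. ereal_of_enat (covering_number r (cball x R \<inter> F)))"
        using S by (intro SUP_upper) (auto simp: packing_def)
      also have "\<dots> \<le> ereal (C * (R / r) powr \<alpha>)"
        using adm rR n_\<rho> by auto
      finally have "real (card S) \<le> C * (R / r) powr \<alpha>" by simp
      also have "\<dots> \<le> real (Suc n) * (R / r) powr \<alpha>" using n_C by (intro mult_right_mono) auto
      finally show "real (card S) \<le> real (Suc n) * (R / r) powr \<alpha>" .
    qed
    then show "(INF n. packing_exponent n F) \<le> a" unfolding a by (meson INF_lower UNIV_I order_trans)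
  qed
qed

lemma packing_exponent_tendsto_assouad_dim:
  "(\<lambda>n. packing_exponent n F) \<longlonglongrightarrow> assouad_dim F"
  unfolding assouad_dim_eq_INF_packing_exponent
  by (rule LIMSEQ_INF) (rule decseq_packing_exponent)

section \<open>Lower semicontinuity in the Hausdorff metric\<close>

text \<open>All inequalities in \<open>packing\<close> are strict and finitely many, so they hold with a common
  slack \<open>2\<delta>\<close>. Moving the centre and the points to points of \<open>G\<close> at distance
  less than \<open>\<delta>\<close> changes each mutual distance by less than \<open>2\<delta>\<close>; in particular
  distinct points stay distinct.\<close>

lemma packing_stable:
  assumes "packing r R F x S" and "0 \<le> r"
  obtains \<delta> where "\<delta> > 0"
    and "\<And>G. F \<subseteq> nbhd \<delta> G \<Longrightarrow> \<exists>x' S'. packing r R G x' S' \<and> card S' = card S"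
proof -
  from assms have x: "x \<in> F" and fin: "finite S" and ne: "S \<noteq> {}" and sub: "S \<subseteq> F \<inter> ball x R"
    and sep: "pairwise (\<lambda>y z. r < dist y z) S"
    by (auto simp: packing_def)
  define A where "A = (\<lambda>y. R - dist x y) ` S
    \<union> (\<lambda>(y, z). dist y z - r) ` {(y, z) \<in> S \<times> S. y \<noteq> z}"
  have "finite {(y, z) \<in> S \<times> S. y \<noteq> z}"
    by (rule finite_subset[of _ "S \<times> S"]) (use fin in auto)
  then have finA: "finite A" unfolding A_def using fin by blast
  have "\<forall>a\<in>A. a > 0" using sub sep by (auto simp: A_def pairwise_def)
  moreover have "A \<noteq> {}" using ne by (simp add: A_def)
  ultimately have Min: "Min A > 0" using finA by simp
  define \<delta> where "\<delta> = Min A / 2"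
  have slack: "2 * \<delta> \<le> a" if "a \<in> A" for a using Min_le[OF finA that] by (simp add: \<delta>_def)
  have ball: "dist x y + 2 * \<delta> \<le> R" if "y \<in> S" for y
    using slack[of "R - dist x y"] that by (auto simp: A_def)
  have sep': "r + 2 * \<delta> \<le> dist y z" if "y \<in> S" "z \<in> S" "y \<noteq> z" for y z
    using slack[of "dist y z - r"] that by (force simp: A_def)
  show ?thesis
  proof
    show "\<delta> > 0" using Min by (simp add: \<delta>_def)
    fix G assume "F \<subseteq> nbhd \<delta> G"
    then have "\<forall>y\<in>F. \<exists>y'\<in>G. dist y' y < \<delta>" by (force simp: nbhd_def)
    then obtain p where p: "\<And>y. y \<in> F \<Longrightarrow> p y \<in> G \<and> dist (p y) y < \<delta>" by metis
    have perturb: "\<bar>dist (p y) (p z) - dist y z\<bar> < 2 * \<delta>" if "y \<in> F" "z \<in> F" for y z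
      using p[OF that(1)] p[OF that(2)] dist_triangle[of "p y" "p z" y] dist_triangle[of y "p z" z]
        dist_triangle[of y z "p y"] dist_triangle[of "p y" z "p z"]
      by (auto simp: dist_commute abs_less_iff)
    have ball': "dist (p x) (p y) < R" if "y \<in> S" for y
      using perturb[of x y] ball[OF that] x sub that by auto
    have far: "r < dist (p y) (p z)" if "y \<in> S" "z \<in> S" "y \<noteq> z" for y z
    proof -
      have "y \<in> F" "z \<in> F" using sub that by auto
      then show ?thesis using perturb[of y z] sep'[OF that] by linarith
    qed
    have "inj_on p S" using far \<open>0 \<le> r\<close> by (force intro!: inj_onI)
    then have "card (p ` S) = card S" by (rule card_image)
    moreover have "packing r R G (p x) (p ` S)"
      using x fin ne sub p ball' far by (auto simp: packing_def pairwise_def)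
    ultimately show "\<exists>x' S'. packing r R G x' S' \<and> card S' = card S" by blast
  qed
qed

text \<open>A packing that witnesses \<open>t < packing_exponent n K\<close> can be moved, with the same scales and
  cardinality and hence the same logarithm, into each compact set close to \<open>K\<close>.\<close>

lemma open_packing_exponent_greater:
  "open {K :: 'a::metric_space compacts. ereal t < packing_exponent n (set_of_compacts K)}"
  unfolding open_dist
proof (intro ballI)
  fix K :: "'a compacts"
  assume "K \<in> {K. ereal t < packing_exponent n (set_of_compacts K)}"
  then obtain r R x S where rR: "0 < r" "r < R" "R \<le> 1 / real (Suc n)"
    and S: "packing r R (set_of_compacts K) x S"
    and t: "t < log (R / r) (real (card S) / real (Suc n))"
    by (auto simp: packing_exponent_def less_Sup_iff)
  obtain \<delta> where \<delta>: "\<delta> > 0" "\<And>G. set_of_compacts K \<subseteq> nbhd \<delta> G \<Longrightarrow>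
      \<exists>x' S'. packing r R G x' S' \<and> card S' = card S"
    by (rule packing_stable[OF S]) (use rR in auto)
  have "ereal t < packing_exponent n (set_of_compacts L)" if "dist L K < \<delta>" for L
  proof -
    have "set_of_compacts K \<subseteq> nbhd \<delta> (set_of_compacts L)"
      using that by (intro hausdorff_dist_witness(3)[of "set_of_compacts L"])
        (simp_all add: set_of_compacts dist_compacts_def)
    then obtain x' S' where S': "packing r R (set_of_compacts L) x' S'" "card S' = card S"
      using \<delta>(2) by blast
    have "ereal t < ereal (log (R / r) (real (card S') / real (Suc n)))" using t S'(2) by simp
    also have "\<dots> \<le> packing_exponent n (set_of_compacts L)"
      unfolding packing_exponent_def using rR S'(1) by (intro Sup_upper) blast
    finally show ?thesis .
  qed
  then show "\<exists>e>0. \<forall>L. dist L K < e \<longrightarrow> L \<in> {K. ereal t < packing_exponent n (set_of_compacts K)}"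
    using \<delta>(1) by blast
qed

section \<open>The Baire class of the Assouad dimension\<close>

text \<open>The clipped value is finite, so \<^const>\<open>real_of_ereal\<close> never falls back to \<open>0\<close> at an infinity.\<close>

definition clipped_exponent :: "nat \<Rightarrow> 'a::metric_space compacts \<Rightarrow> real" where
  "clipped_exponent n K =
     real_of_ereal (max (ereal (- real n)) (min (ereal (real n)) (packing_exponent n (set_of_compacts K))))"

lemma ereal_clipped_exponent:
  "ereal (clipped_exponent n K) =
     max (ereal (- real n)) (min (ereal (real n)) (packing_exponent n (set_of_compacts K)))"
  unfolding clipped_exponent_def
  by (cases "packing_exponent n (set_of_compacts K)") (auto simp: max_def min_def)

lemma baire_class_1_clipped_exponent:
  "baire_class 1 (clipped_exponent n :: 'a::metric_space compacts \<Rightarrow> real)"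
proof (rule lower_semicontinuous_imp_baire_class_1)
  fix K :: "'a compacts"
  have "ereal (- real n) \<le> ereal (clipped_exponent n K)"
    unfolding ereal_clipped_exponent by simp
  then show "- real n \<le> clipped_exponent n K" by simp
next
  fix t :: real
  have "t < clipped_exponent n K \<longleftrightarrow>
      t < - real n \<or> t < real n \<and> ereal t < packing_exponent n (set_of_compacts K)" for K :: "'a compacts"
  proof -
    have "t < clipped_exponent n K \<longleftrightarrow> ereal t < ereal (clipped_exponent n K)" by simp
    also have "\<dots> \<longleftrightarrow> t < - real n \<or> t < real n \<and> ereal t < packing_exponent n (set_of_compacts K)"
      unfolding ereal_clipped_exponent less_max_iff_disj min_less_iff_conj by simp
    finally show ?thesis .
  qed
  then have "{K :: 'a compacts. t < clipped_exponent n K} =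
      {K. t < - real n} \<union> ({K. t < real n} \<inter> {K. ereal t < packing_exponent n (set_of_compacts K)})"
    by auto
  then show "open {K :: 'a compacts. t < clipped_exponent n K}"
    using open_packing_exponent_greater[of t n] by auto
qed

lemma clipped_exponent_tendsto: "(\<lambda>n. ereal (clipped_exponent n K)) \<longlonglongrightarrow> Delta_A K"
proof -
  have top: "(\<lambda>n. ereal (real n)) \<longlonglongrightarrow> \<infinity>"
    by (simp add: tendsto_PInfty_eq_at_top filterlim_real_sequentially)
  have bot: "(\<lambda>n. ereal (- real n)) \<longlonglongrightarrow> -\<infinity>"
    using tendsto_uminus_ereal[OF top] by simp
  have "(\<lambda>n. max (ereal (- real n)) (min (ereal (real n)) (packing_exponent n (set_of_compacts K))))
      \<longlonglongrightarrow> max (-\<infinity>) (min \<infinity> (assouad_dim (set_of_compacts K)))"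
    by (intro tendsto_max tendsto_min top bot packing_exponent_tendsto_assouad_dim)
  then show ?thesis by (simp add: ereal_clipped_exponent Delta_A_def)
qed

theorem theorem2p6:
  assumes "compact (UNIV :: 'a::metric_space set)"
  shows "baire_class 2 (Delta_A :: 'a compacts \<Rightarrow> ereal)
    \<and> (Delta_A :: 'a compacts \<Rightarrow> ereal) \<in> borel_measurable borel
    \<and> ((\<forall>F :: 'a compacts. \<bar>Delta_A F\<bar> \<noteq> \<infinity>) \<longrightarrow>
         baire_class 2 (\<lambda>F :: 'a compacts. real_of_ereal (Delta_A F))
         \<and> (\<lambda>F :: 'a compacts. real_of_ereal (Delta_A F)) \<in> borel_measurable borel)"
proof (intro conjI impI)
  have two: "(2::nat) = Suc 1" by simp
  show baire: "baire_class 2 (Delta_A :: 'a compacts \<Rightarrow> ereal)"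
    unfolding two baire_class.simps(2)
    by (intro exI[of _ "\<lambda>n K. ereal (clipped_exponent n K)"] conjI allI
        baire_class_ereal baire_class_1_clipped_exponent clipped_exponent_tendsto)
  show borel: "(Delta_A :: 'a compacts \<Rightarrow> ereal) \<in> borel_measurable borel"
    using baire by (rule baire_class_imp_borel_measurable)
  then show "(\<lambda>F :: 'a compacts. real_of_ereal (Delta_A F)) \<in> borel_measurable borel"
    by measurable
  assume finite: "\<forall>F :: 'a compacts. \<bar>Delta_A F\<bar> \<noteq> \<infinity>"
  have "(\<lambda>n. clipped_exponent n F) \<longlonglongrightarrow> real_of_ereal (Delta_A F)" for F :: "'a compacts"
  proof -
    have "ereal (real_of_ereal (Delta_A F)) = Delta_A F" using finite by (simp add: ereal_real')
    then show ?thesis using clipped_exponent_tendsto[of F] by (metis lim_ereal)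
  qed
  then show "baire_class 2 (\<lambda>F :: 'a compacts. real_of_ereal (Delta_A F))"
    unfolding two baire_class.simps(2) using baire_class_1_clipped_exponent by blast
qed

end
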